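(* Let $t_0>0$, $\mu>0$, $\alpha_0>0$ and $\eta>1$, and suppose that for all $t\ge t_0$ $$\alpha(t)=\alpha_0 t,\qquad \gamma(t)=\frac{\eta+\alpha_0}{\alpha_0 t},\qquad b(t)=t^{\frac1{\alpha_0}-2}.$$ Suppose that the set $\mathscr S$ of saddle points of $\mathcal L$ is non-empty and let $(x^\star,y^\star,\lambda^\star)\in\mathscr S$. Then any solution trajectory $(x(\cdot),y(\cdot),\lambda(\cdot))$ of (TRIALS) on $[t_0,+\infty[$ is bounded, and, as $t\to+\infty$, $$\mathcal L(x(t),y(t),\lambda^\star)-\mathcal L(x^\star,y^\star,\lambda^\star)=\mathcal O\big(t^{-1/\alpha_0}\big),$$ $$\|Ax(t)+By(t)-c\|^2=\mathcal O\big(t^{-1/\alpha_0}\big),$$ $$\|(\dot x(t),\dot y(t),\dot\lambda(t))\|=\mathcal O(1/t),$$ and there are positive constants $C_1,C_2$ such that $$-\frac{C_1}{t^{\frac{1}{2\alpha_0}}}\le F(x(t),y(t))-F(x^\star,y^\star)\le \frac{C_2}{t^{\frac1{\alpha_0}}}.$$ In particular, for $\alpha_0=\tfrac12$ (so that $b\equiv1$), $$\mathcal L(x(t),y(t),\lambda^\star)-\mathcal L(x^\star,y^\star,\lambda^\star)=\mathcal O(1/t^2),\quad \|Ax(t)+By(t)-c\|^2=\mathcal O(1/t^2),\quad -\frac{C_1}{t}\le F(x(t),y(t))-F(x^\star,y^\star)\le\frac{C_2}{t^2}.$$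
   Context: Standing assumptions: $\mathcal X,\mathcal Y,\mathcal Z$ are real Hilbert spaces; $f:\mathcal X\to\mathbb R$ and $g:\mathcal Y\to\mathbb R$ are convex and of class $C^1$; $A:\mathcal X\to\mathcal Z$ and $B:\mathcal Y\to\mathcal Z$ are continuous linear operators with adjoints $A^*,B^*$; $c\in\mathcal Z$; $F(x,y):=f(x)+g(y)$; the problem $\min\{F(x,y): Ax+By=c\}$ has a non-empty solution set. Lagrangian: $\mathcal L(x,y,\lambda):=F(x,y)+\langle\lambda,Ax+By-c\rangle$. A saddle point of $\mathcal L$ is $(x^\star,y^\star,\lambda^\star)$ with $\mathcal L(x^\star,y^\star,\lambda)\le\mathcal L(x^\star,y^\star,\lambda^\star)\le\mathcal L(x,y,\lambda^\star)$ for all $(x,y,\lambda)\in\mathcal X\times\mathcal Y\times\mathcal Z$; $\mathscr S$ is the set of saddle points. The system (TRIALS), with parameters $\gamma,\alpha,b:[t_0,+\infty[\to\mathbb R^+$ and $\mu>0$, is, for $t\ge t_0$, $$\begin{cases}\ddot x+\gamma(t)\dot x+b(t)\big(\nabla f(x)+A^*[\lambda+\alpha(t)\dot\lambda+\mu(Ax+By-c)]\big)=0\\ \ddot y+\gamma(t)\dot y+b(t)\big(\nabla g(y)+B^*[\lambda+\alpha(t)\dot\lambda+\mu(Ax+By-c)]\big)=0\\ \ddot\lambda+\gamma(t)\dot\lambda-b(t)\big(A(x+\alpha(t)\dot x)+B(y+\alpha(t)\dot y)-c\big)=0\end{cases}$$ with arbitrary initial position and velocity at $t_0$. A solution trajectory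 is a classical ($C^2$) solution on $[t_0,+\infty[$. *)

theory Defs
  imports "HOL-Analysis.Analysis"
begin

text \<open>Real Hilbert spaces are types of sort \<open>{real_inner, complete_space}\<close>.\<close>

text \<open>Class \<open>C\<^sup>1\<close>: the Frechet derivative exists everywhere and is continuous
  in the operator norm.\<close>

definition class_C1 :: "('a::real_normed_vector \<Rightarrow> real) \<Rightarrow> bool" where
  "class_C1 f \<longleftrightarrow> (\<exists>f' :: 'a \<Rightarrow> 'a \<Rightarrow>\<^sub>L real.
     (\<forall>x. (f has_derivative blinfun_apply (f' x)) (at x)) \<and> continuous_on UNIV f')"

text \<open>The Riesz representative of the derivative; on a Hilbert space it exists wherever
  \<open>f\<close> is differentiable. For the same reason the library's \<open>adjoint\<close>, defined by choice,
  is the Hilbert space adjoint of any bounded linear operator.\<close>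

definition gradient :: "('a::real_inner \<Rightarrow> real) \<Rightarrow> 'a \<Rightarrow> 'a" where
  "gradient f x = (THE D. GDERIV f x :> D)"

definition objective :: "('x \<Rightarrow> real) \<Rightarrow> ('y \<Rightarrow> real) \<Rightarrow> 'x \<Rightarrow> 'y \<Rightarrow> real" where
  "objective f g x y = f x + g y"

definition solution_set ::
  "('x \<Rightarrow> real) \<Rightarrow> ('y \<Rightarrow> real) \<Rightarrow> ('x \<Rightarrow> 'z) \<Rightarrow> ('y \<Rightarrow> 'z::ab_group_add) \<Rightarrow> 'z \<Rightarrow> ('x \<times> 'y) set" where
  "solution_set f g A B c = {(x, y). A x + B y = c \<and>
     (\<forall>x' y'. A x' + B y' = c \<longrightarrow> objective f g x y \<le> objective f g x' y')}"

definition lagrangian ::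
  "('x \<Rightarrow> real) \<Rightarrow> ('y \<Rightarrow> real) \<Rightarrow> ('x \<Rightarrow> 'z) \<Rightarrow> ('y \<Rightarrow> 'z::real_inner) \<Rightarrow> 'z
    \<Rightarrow> 'x \<Rightarrow> 'y \<Rightarrow> 'z \<Rightarrow> real" where
  "lagrangian f g A B c x y l = objective f g x y + l \<bullet> (A x + B y - c)"

definition saddle_points ::
  "('x \<Rightarrow> real) \<Rightarrow> ('y \<Rightarrow> real) \<Rightarrow> ('x \<Rightarrow> 'z) \<Rightarrow> ('y \<Rightarrow> 'z::real_inner) \<Rightarrow> 'z \<Rightarrow> ('x \<times> 'y \<times> 'z) set" where
  "saddle_points f g A B c = {(xs, ys, ls). \<forall>x y l.
     lagrangian f g A B c xs ys l \<le> lagrangian f g A B c xs ys ls \<and>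
     lagrangian f g A B c xs ys ls \<le> lagrangian f g A B c x y ls}"

text \<open>Time derivative on \<open>[t\<^sub>0, +\<infinity>[\<close>: one-sided at \<open>t\<^sub>0\<close>, two-sided for \<open>t > t\<^sub>0\<close>.\<close>

definition tderiv :: "real \<Rightarrow> (real \<Rightarrow> 'a::real_normed_vector) \<Rightarrow> real \<Rightarrow> 'a" where
  "tderiv t0 u t = vector_derivative u (at t within {t0..})"

definition C2_from :: "real \<Rightarrow> (real \<Rightarrow> 'a::real_normed_vector) \<Rightarrow> bool" where
  "C2_from t0 u \<longleftrightarrow> u differentiable_on {t0..} \<and> tderiv t0 u differentiable_on {t0..} \<and>
     continuous_on {t0..} (tderiv t0 (tderiv t0 u))"

definition trials_solution ::
  "('x::real_inner \<Rightarrow> real) \<Rightarrow> ('y::real_inner \<Rightarrow> real) \<Rightarrow> ('x \<Rightarrow> 'z) \<Rightarrow> ('y \<Rightarrow> 'z::real_inner) \<Rightarrow> 'z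
    \<Rightarrow> real \<Rightarrow> (real \<Rightarrow> real) \<Rightarrow> (real \<Rightarrow> real) \<Rightarrow> (real \<Rightarrow> real) \<Rightarrow> real
    \<Rightarrow> (real \<Rightarrow> 'x) \<Rightarrow> (real \<Rightarrow> 'y) \<Rightarrow> (real \<Rightarrow> 'z) \<Rightarrow> bool" where
  "trials_solution f g A B c \<mu> \<gamma> \<alpha> b t0 x y l \<longleftrightarrow>
     C2_from t0 x \<and> C2_from t0 y \<and> C2_from t0 l \<and>
     (\<forall>t\<ge>t0.
       tderiv t0 (tderiv t0 x) t + \<gamma> t *\<^sub>R tderiv t0 x t
         + b t *\<^sub>R (gradient f (x t)
             + adjoint A (l t + \<alpha> t *\<^sub>R tderiv t0 l t + \<mu> *\<^sub>R (A (x t) + B (y t) - c))) = 0 \<and>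
       tderiv t0 (tderiv t0 y) t + \<gamma> t *\<^sub>R tderiv t0 y t
         + b t *\<^sub>R (gradient g (y t)
             + adjoint B (l t + \<alpha> t *\<^sub>R tderiv t0 l t + \<mu> *\<^sub>R (A (x t) + B (y t) - c))) = 0 \<and>
       tderiv t0 (tderiv t0 l) t + \<gamma> t *\<^sub>R tderiv t0 l t
         - b t *\<^sub>R (A (x t + \<alpha> t *\<^sub>R tderiv t0 x t) + B (y t + \<alpha> t *\<^sub>R tderiv t0 y t) - c) = 0)"

end

theory Submission
  imports Defs
begin

text \<open>Write \<open>u = (x, y, l)\<close>, \<open>r = A x + B y - c\<close>, fix an arbitrary multiplier \<open>q\<close>, put
  \<open>p = (xs, ys, q)\<close>, and let \<open>W = F(x, y) - F(xs, ys) + q \<bullet> r + \<mu> \<parallel>r\<parallel>\<^sup>2/2\<close> be the augmented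
  Lagrangian gap at \<open>q\<close>. The proof rests on the Lyapunov function
  \<open>E = a\<^sup>2 t powr (1/a) W + \<parallel>u - p + a t u'\<parallel>\<^sup>2/2 + (\<eta> - 1) \<parallel>u - p\<parallel>\<^sup>2/2\<close>, where \<open>a\<close> stands for
  the coefficient \<open>\<alpha>0\<close> of the extrapolation. The three coefficients of the system are tuned to each
  other so that in \<open>E'\<close> the acceleration can be eliminated without a trace
  (\<open>anchored_energy_derivative\<close>), the primal and dual couplings cancel (\<open>force_work\<close>), and the
  growth of the weight \<open>a\<^sup>2 t powr (1/a)\<close> is paid for by the convexity of \<open>f\<close> and \<open>g\<close>
  (\<open>energy_derivative_nonpos\<close>). Hence \<open>E\<close> is nonincreasing and \<open>W = O(t powr (-1/a))\<close> from above.

  This decay holds for every multiplier \<open>q\<close>, and two choices give the theorem. For \<open>q = ls\<close>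
  the saddle point property makes \<open>W\<close> a sum of two nonnegative terms, the Lagrangian gap
  and the penalty, so both decay at the rate of \<open>W\<close>; the remaining two squares in \<open>E\<close> then bound
  \<open>u\<close> and \<open>t u'\<close>, and the Cauchy-Schwarz inequality applied to
  \<open>F(x, y) - F(xs, ys) \<ge> - (ls \<bullet> r)\<close> gives the lower estimate for the objective, at half the
  exponent. For \<open>q = 0\<close> the gap \<open>W\<close> dominates \<open>F(x, y) - F(xs, ys)\<close> itself, which is why the
  upper estimate has the full exponent.

  To compute with \<open>gradient\<close> and \<open>adjoint\<close>, which are defined by description and choice, one needs that the
  vectors they are meant to pick exist; this is the Riesz representation theorem.\<close>

section \<open>Gradients and adjoints in Hilbert spaces\<close>

text \<open>Riesz representation. The convex functional \<open>J x = \<parallel>x\<parallel>\<^sup>2/2 - \<phi> x\<close> is bounded below, and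
  the parallelogram identity makes every minimising sequence Cauchy; Fermat's rule at the minimiser
  \<open>z\<close> reads \<open>z \<bullet> h = \<phi> h\<close>.\<close>

lemma riesz_representation:
  fixes \<phi> :: "'a::{real_inner, complete_space} \<Rightarrow> real"
  assumes "bounded_linear \<phi>"
  obtains z where "\<And>h. \<phi> h = h \<bullet> z"
proof -
  interpret bounded_linear \<phi> by fact
  define J where "J x = (norm x)\<^sup>2 / 2 - \<phi> x" for x
  obtain K where K: "\<And>x. norm (\<phi> x) \<le> norm x * K"
    using bounded by blast
  have "- (K\<^sup>2 / 2) \<le> J x" for x
  proof -
    have "\<phi> x \<le> norm x * K" using K[of x] by simp
    moreover have "0 \<le> (norm x - K)\<^sup>2" by simp
    ultimately show ?thesis unfolding J_def power2_diff by linarith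
  qed
  then have bdd: "bdd_below (range J)" by (auto intro!: bdd_belowI)
  define m where "m = (INF x. J x)"
  have m_le: "m \<le> J x" for x
    unfolding m_def using bdd by (simp add: cINF_lower)
  have "\<exists>x. J x < m + 1 / real (Suc n)" for n
  proof -
    have "m < m + 1 / real (Suc n)" by simp
    then show ?thesis unfolding m_def by (subst (asm) cINF_less_iff) (use bdd in auto)
  qed
  then obtain X where X: "\<And>n. J (X n) < m + 1 / real (Suc n)" by metis
  have gap: "(norm (u - v))\<^sup>2 \<le> 4 * (J u + J v - 2 * m)" for u v
  proof -
    have "J ((1/2) *\<^sub>R (u + v)) = (J u + J v) / 2 - (norm (u - v))\<^sup>2 / 8"
      unfolding J_def power2_norm_eq_inner scaleR add
      by (simp add: inner_add inner_diff inner_commute[of v u] field_simps)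
    with m_le[of "(1/2) *\<^sub>R (u + v)"] show ?thesis by (simp add: field_simps)
  qed
  have "Cauchy X"
  proof (rule metric_CauchyI)
    fix e :: real assume "e > 0"
    then obtain N :: nat where N: "1 / real (Suc N) < e\<^sup>2 / 8"
      using reals_Archimedean[of "e\<^sup>2 / 8"] by (auto simp: inverse_eq_divide)
    have small: "J (X n) < m + e\<^sup>2 / 8" if "n \<ge> N" for n
    proof -
      have "1 / real (Suc n) \<le> 1 / real (Suc N)" using that by (simp add: frac_le)
      with X[of n] N show ?thesis by linarith
    qed
    have "dist (X i) (X j) < e" if "i \<ge> N" "j \<ge> N" for i j
    proof -
      have "(norm (X i - X j))\<^sup>2 < e\<^sup>2"
        using gap[of "X i" "X j"] small[OF that(1)] small[OF that(2)]
        by (simp add: field_simps)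
      then show ?thesis using \<open>e > 0\<close> by (simp add: dist_norm power_less_imp_less_base)
    qed
    then show "\<exists>N. \<forall>i\<ge>N. \<forall>j\<ge>N. dist (X i) (X j) < e" by blast
  qed
  then obtain z where z: "X \<longlonglongrightarrow> z" using Cauchy_convergent convergent_def by blast
  have "(\<lambda>n. J (X n)) \<longlonglongrightarrow> J z"
    unfolding J_def by (intro tendsto_intros tendsto z) simp
  moreover have "(\<lambda>n. m + 1 / real (Suc n)) \<longlonglongrightarrow> m + 0"
    by (intro tendsto_intros LIMSEQ_Suc lim_1_over_n)
  ultimately have "J z \<le> m + 0"
    by (rule LIMSEQ_le) (use X less_imp_le in blast)
  then have min: "J z \<le> J w" for w using m_le[of w] by simp
  have "\<phi> h = h \<bullet> z" for h
  proof (rule ccontr)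
    define k where "k = h \<bullet> z - \<phi> h"
    define n where "n = (norm h)\<^sup>2"
    assume "\<phi> h \<noteq> h \<bullet> z"
    then have k: "k \<noteq> 0" by (simp add: k_def)
    have n: "n \<ge> 0" by (simp add: n_def)
    have "J (z + s *\<^sub>R h) = J z + s * k + s\<^sup>2 * n / 2" for s
      unfolding J_def k_def n_def power2_norm_eq_inner scaleR add
      by (simp add: inner_add inner_commute[of z h] power2_eq_square field_simps)
    then have variation: "0 \<le> s * k + s\<^sup>2 * n / 2" for s
      using min[of "z + s *\<^sub>R h"] by simp
    \<comment> \<open>Along \<open>h\<close> the increment of \<open>J\<close> is \<open>s k + s\<^sup>2 n/2\<close>, negative at \<open>s = - k/(n + 1)\<close>; the \<open>+ 1\<close>
      covers \<open>n = 0\<close>.\<close>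
    define q where "q = k / (n + 1)"
    have "k = q * (n + 1)" using n by (simp add: q_def)
    with variation[of "- q"] have "q\<^sup>2 * (n / 2 + 1) \<le> 0"
      by (simp add: power2_eq_square algebra_simps)
    moreover have "q\<^sup>2 * (n / 2 + 1) > 0"
      using k n by (intro mult_pos_pos) (auto simp: q_def)
    ultimately show False by linarith
  qed
  then show thesis by (rule that)
qed

lemma has_derivative_gradient:
  fixes f :: "'a::{real_inner, complete_space} \<Rightarrow> real"
  assumes "class_C1 f"
  shows "(f has_derivative (\<lambda>h. h \<bullet> gradient f x)) (at x)"
proof -
  from assms obtain f' where f': "(f has_derivative f') (at x)"
    unfolding class_C1_def by blast
  obtain D where "\<And>h. f' h = h \<bullet> D"
    using riesz_representation[OF has_derivative_bounded_linear[OF f']] by blast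
  then have "GDERIV f x :> D" using f' unfolding gderiv_def by presburger
  moreover have "E = D" if "GDERIV f x :> E" for E
  proof -
    have "(\<lambda>h. h \<bullet> E) = (\<lambda>h. h \<bullet> D)"
      using that \<open>GDERIV f x :> D\<close> has_derivative_unique unfolding gderiv_def by blast
    then show ?thesis by (metis vector_eq_rdot inner_commute)
  qed
  ultimately have "GDERIV f x :> gradient f x"
    unfolding gradient_def by (rule theI)
  then show ?thesis unfolding gderiv_def .
qed

lemma adjoint_inner:
  fixes A :: "'a::{real_inner, complete_space} \<Rightarrow> 'b::real_inner"
  assumes "bounded_linear A"
  shows "adjoint A w \<bullet> v = w \<bullet> A v"
proof -
  have "\<exists>z. \<forall>v. A v \<bullet> w = v \<bullet> z" for w
  proof -
    have "bounded_linear (\<lambda>v. A v \<bullet> w)"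
      using bounded_linear_compose[OF bounded_linear_inner_left assms] .
    then show ?thesis using riesz_representation by blast
  qed
  then obtain A' where "\<forall>v w. A v \<bullet> w = v \<bullet> A' w" by metis
  then show ?thesis using adjoint_unique by (metis inner_commute)
qed

text \<open>Restricting \<open>f\<close> to the line through \<open>x\<close> and \<open>z\<close> reduces the claim to the tangent inequality
  for convex functions of one real variable.\<close>

lemma convex_gradient_inequality:
  fixes f :: "'a::{real_inner, complete_space} \<Rightarrow> real"
  assumes "convex_on UNIV f" "class_C1 f"
  shows "f x - f z \<le> gradient f x \<bullet> (x - z)"
proof -
  define \<phi> where "\<phi> s = f (x + s *\<^sub>R (z - x))" for s :: real
  have conv: "convex_on UNIV \<phi>"
  proof (rule convex_onI)
    fix s a b :: real assume "0 < s" "s < 1"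
    have "x + ((1 - s) * a + s * b) *\<^sub>R (z - x)
        = (1 - s) *\<^sub>R (x + a *\<^sub>R (z - x)) + s *\<^sub>R (x + b *\<^sub>R (z - x))"
      by (simp add: algebra_simps)
    then show "\<phi> ((1 - s) *\<^sub>R a + s *\<^sub>R b) \<le> (1 - s) * \<phi> a + s * \<phi> b"
      unfolding \<phi>_def using convex_onD[OF assms(1), of s "x + a *\<^sub>R (z - x)" "x + b *\<^sub>R (z - x)"]
        \<open>0 < s\<close> \<open>s < 1\<close> by simp
  qed simp
  have "((\<lambda>s. x + s *\<^sub>R (z - x)) has_derivative (\<lambda>s. s *\<^sub>R (z - x))) (at 0)"
    by (auto intro!: derivative_eq_intros)
  moreover have "(f has_derivative (\<lambda>h. h \<bullet> gradient f x)) (at (x + 0 *\<^sub>R (z - x)))"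
    using has_derivative_gradient[OF assms(2), of x] by simp
  ultimately have "(\<phi> has_derivative (\<lambda>s. (s *\<^sub>R (z - x)) \<bullet> gradient f x)) (at 0)"
    unfolding \<phi>_def by (rule has_derivative_compose)
  then have "(\<phi> has_real_derivative (z - x) \<bullet> gradient f x) (at 0)"
    unfolding has_field_derivative_def by (rule has_derivative_eq_rhs) auto
  then have "(z - x) \<bullet> gradient f x * (1 - 0) \<le> \<phi> 1 - \<phi> 0"
    by (intro convex_on_imp_above_tangent[OF conv]) auto
  then show ?thesis
    by (simp add: \<phi>_def inner_diff_left inner_diff_right inner_commute)
qed

section \<open>The Lyapunov function of the trajectory\<close>

lemma half_norm_square_derivative:
  fixes w :: "real \<Rightarrow> 'a::real_inner"
  assumes "(w has_vector_derivative w') (at t within S)"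
  shows "((\<lambda>s. (norm (w s))\<^sup>2 / 2) has_real_derivative w' \<bullet> w t) (at t within S)"
proof -
  have "((\<lambda>s. w s \<bullet> w s) has_derivative (\<lambda>h. w t \<bullet> (h *\<^sub>R w') + (h *\<^sub>R w') \<bullet> w t)) (at t within S)"
    using assms unfolding has_vector_derivative_def by (intro has_derivative_inner)
  then have "((\<lambda>s. w s \<bullet> w s) has_real_derivative 2 * (w' \<bullet> w t)) (at t within S)"
    unfolding has_field_derivative_def
    by (rule has_derivative_eq_rhs) (auto simp: inner_commute)
  then have "((\<lambda>s. (w s \<bullet> w s) / 2) has_real_derivative 2 * (w' \<bullet> w t) / 2) (at t within S)"
    by (rule DERIV_cdivide)
  then show ?thesis by (simp add: power2_norm_eq_inner)
qed

text \<open>The friction coefficient is tuned so that the acceleration disappears from the anchored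
  velocity \<open>v = u - p + a t u'\<close>: the equation gives \<open>v' = (1 - \<eta>) u' - a t b G\<close>. The cross term
  \<open>(1 - \<eta>) u' \<bullet> (u - p)\<close> that this produces in \<open>v' \<bullet> v\<close> is cancelled by the derivative of
  \<open>(\<eta> - 1) \<parallel>u - p\<parallel>\<^sup>2/2\<close>, which leaves only a dissipation and the work of the force \<open>G\<close>.\<close>

lemma anchored_energy_derivative:
  fixes u u1 :: "real \<Rightarrow> 'a::real_inner"
  assumes u: "(u has_vector_derivative u1 t) (at t within S)"
    and u1: "(u1 has_vector_derivative u2) (at t within S)"
    and ode: "u2 + ((\<eta> + a) / (a * t)) *\<^sub>R u1 t + b *\<^sub>R G = 0"
    and nz: "a * t \<noteq> 0"
  shows "((\<lambda>s. (norm (u s - p + (a * s) *\<^sub>R u1 s))\<^sup>2 / 2 + (\<eta> - 1) * ((norm (u s - p))\<^sup>2 / 2))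
    has_real_derivative
      - (\<eta> - 1) * (a * t) * (norm (u1 t))\<^sup>2
      - a * t * b * (G \<bullet> (u t - p + (a * t) *\<^sub>R u1 t))) (at t within S)"
proof -
  have "u2 = (u2 + ((\<eta> + a) / (a * t)) *\<^sub>R u1 t + b *\<^sub>R G)
      - ((\<eta> + a) / (a * t)) *\<^sub>R u1 t - b *\<^sub>R G" by simp
  then have "u2 = - (((\<eta> + a) / (a * t)) *\<^sub>R u1 t) - b *\<^sub>R G"
    unfolding ode by simp
  then have "(a * t) *\<^sub>R u2 = (a * t) *\<^sub>R (- (((\<eta> + a) / (a * t)) *\<^sub>R u1 t) - b *\<^sub>R G)"
    by simp
  also have "\<dots> = - ((\<eta> + a) *\<^sub>R u1 t) - (a * t * b) *\<^sub>R G"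
    using nz by (simp add: scaleR_diff_right)
  finally have acc: "(a * t) *\<^sub>R u2 = - ((\<eta> + a) *\<^sub>R u1 t) - (a * t * b) *\<^sub>R G" .
  have "((\<lambda>s. u s - p + (a * s) *\<^sub>R u1 s) has_vector_derivative
      u1 t - 0 + ((a * t) *\<^sub>R u2 + (a * 1) *\<^sub>R u1 t)) (at t within S)"
    by (intro has_vector_derivative_add has_vector_derivative_diff has_vector_derivative_const
        has_vector_derivative_scaleR u u1 DERIV_cmult DERIV_ident)
  moreover have "u1 t - 0 + ((a * t) *\<^sub>R u2 + (a * 1) *\<^sub>R u1 t)
      = (1 - \<eta>) *\<^sub>R u1 t - (a * t * b) *\<^sub>R G"
    unfolding acc by (simp add: algebra_simps)
  ultimately have "((\<lambda>s. u s - p + (a * s) *\<^sub>R u1 s) has_vector_derivative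
      (1 - \<eta>) *\<^sub>R u1 t - (a * t * b) *\<^sub>R G) (at t within S)" by simp
  note v' = half_norm_square_derivative[OF this]
  have "((\<lambda>s. u s - p) has_vector_derivative u1 t - 0) (at t within S)"
    by (intro has_vector_derivative_diff has_vector_derivative_const u)
  from half_norm_square_derivative[OF this]
  have p': "((\<lambda>s. (norm (u s - p))\<^sup>2 / 2) has_real_derivative u1 t \<bullet> (u t - p)) (at t within S)"
    by simp
  show ?thesis
    using DERIV_add[OF v' DERIV_cmult[OF p', of "\<eta> - 1"]]
    by (rule DERIV_cong)
      (simp add: power2_norm_eq_inner algebra_simps)
qed

locale trials_trajectory =
  fixes f :: "'x::{real_inner, complete_space} \<Rightarrow> real"
    and g :: "'y::{real_inner, complete_space} \<Rightarrow> real"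
    and A :: "'x \<Rightarrow> 'z::{real_inner, complete_space}"
    and B :: "'y \<Rightarrow> 'z"
    and c :: 'z
    and t0 \<mu> a \<eta> :: real
    and xs :: 'x and ys :: 'y
    and x :: "real \<Rightarrow> 'x" and y :: "real \<Rightarrow> 'y" and l :: "real \<Rightarrow> 'z"
  assumes f: "convex_on UNIV f" "class_C1 f"
    and g: "convex_on UNIV g" "class_C1 g"
    and A: "bounded_linear A" and B: "bounded_linear B"
    and pos: "t0 > 0" "\<mu> > 0" "a > 0" and \<eta>: "\<eta> > 1"
    and feasible: "A xs + B ys = c"
    and solution: "trials_solution f g A B c \<mu> (\<lambda>t. (\<eta> + a) / (a * t)) (\<lambda>t. a * t)
      (\<lambda>t. t powr (1 / a - 2)) t0 x y l"
begin

definition residual :: "real \<Rightarrow> 'z" where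
  "residual t = A (x t) + B (y t) - c"

definition state :: "real \<Rightarrow> 'x \<times> 'y \<times> 'z" where
  "state t = (x t, y t, l t)"

definition velocity :: "real \<Rightarrow> 'x \<times> 'y \<times> 'z" where
  "velocity t = (tderiv t0 x t, tderiv t0 y t, tderiv t0 l t)"

text \<open>The augmented Lagrangian gap between the trajectory and \<open>(xs, ys)\<close> at the multiplier \<open>q\<close>;
  feasibility of \<open>(xs, ys)\<close> removes the penalty terms there.\<close>

definition gap :: "'z \<Rightarrow> real \<Rightarrow> real" where
  "gap q t = objective f g (x t) (y t) - objective f g xs ys + q \<bullet> residual t
     + \<mu> * ((norm (residual t))\<^sup>2 / 2)"

definition energy :: "'z \<Rightarrow> real \<Rightarrow> real" where
  "energy q t = a\<^sup>2 * t powr (1 / a) * gap q t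
     + ((norm (state t - (xs, ys, q) + (a * t) *\<^sub>R velocity t))\<^sup>2 / 2
     + (\<eta> - 1) * ((norm (state t - (xs, ys, q)))\<^sup>2 / 2))"

lemma trajectory_derivatives:
  assumes "t \<ge> t0"
  shows "(x has_vector_derivative tderiv t0 x t) (at t within {t0..})"
    and "(y has_vector_derivative tderiv t0 y t) (at t within {t0..})"
    and "(l has_vector_derivative tderiv t0 l t) (at t within {t0..})"
    and "(tderiv t0 x has_vector_derivative tderiv t0 (tderiv t0 x) t) (at t within {t0..})"
    and "(tderiv t0 y has_vector_derivative tderiv t0 (tderiv t0 y) t) (at t within {t0..})"
    and "(tderiv t0 l has_vector_derivative tderiv t0 (tderiv t0 l) t) (at t within {t0..})"
  using solution assms
  unfolding trials_solution_def C2_from_def differentiable_on_def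
  by (auto simp: vector_derivative_works tderiv_def[of t0 _ t])

lemma gap_derivative:
  assumes t: "t \<ge> t0"
  shows "(gap q has_real_derivative
      tderiv t0 x t \<bullet> gradient f (x t) + tderiv t0 y t \<bullet> gradient g (y t)
      + (q + \<mu> *\<^sub>R residual t) \<bullet> (A (tderiv t0 x t) + B (tderiv t0 y t))) (at t within {t0..})"
proof -
  note x' = trajectory_derivatives(1)[OF t] and y' = trajectory_derivatives(2)[OF t]
  have fx: "((\<lambda>s. f (x s)) has_real_derivative tderiv t0 x t \<bullet> gradient f (x t)) (at t within {t0..})"
    using has_derivative_compose[OF x'[unfolded has_vector_derivative_def]
        has_derivative_gradient[OF f(2)]]
    unfolding has_field_derivative_def by (rule has_derivative_eq_rhs) auto
  have gy: "((\<lambda>s. g (y s)) has_real_derivative tderiv t0 y t \<bullet> gradient g (y t)) (at t within {t0..})"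
    using has_derivative_compose[OF y'[unfolded has_vector_derivative_def]
        has_derivative_gradient[OF g(2)]]
    unfolding has_field_derivative_def by (rule has_derivative_eq_rhs) auto
  have "(residual has_vector_derivative A (tderiv t0 x t) + B (tderiv t0 y t) - 0) (at t within {t0..})"
    unfolding residual_def[abs_def]
    by (intro has_vector_derivative_add has_vector_derivative_diff has_vector_derivative_const
        bounded_linear.has_vector_derivative[OF A] bounded_linear.has_vector_derivative[OF B] x' y')
  then have r: "(residual has_vector_derivative A (tderiv t0 x t) + B (tderiv t0 y t)) (at t within {t0..})"
    by simp
  have qr: "((\<lambda>s. q \<bullet> residual s) has_real_derivative q \<bullet> (A (tderiv t0 x t) + B (tderiv t0 y t)))
      (at t within {t0..})"
    using bounded_linear.has_vector_derivative[OF bounded_linear_inner_right r]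
    by (simp add: has_real_derivative_iff_has_vector_derivative)
  show ?thesis
    unfolding gap_def[abs_def] objective_def
    using DERIV_add[OF DERIV_add[OF DERIV_diff[OF DERIV_add[OF fx gy] DERIV_const] qr]
        DERIV_cmult[OF half_norm_square_derivative[OF r], of \<mu>]]
    by (rule DERIV_cong) (simp add: inner_commute algebra_simps)
qed

text \<open>The force acting on \<open>state\<close>, with the multiplier equation in the last component.\<close>

definition force :: "real \<Rightarrow> 'x \<times> 'y \<times> 'z" where
  "force t = (let w = l t + (a * t) *\<^sub>R tderiv t0 l t + \<mu> *\<^sub>R residual t in
     (gradient f (x t) + adjoint A w, gradient g (y t) + adjoint B w,
      - (A (x t + (a * t) *\<^sub>R tderiv t0 x t) + B (y t + (a * t) *\<^sub>R tderiv t0 y t) - c)))"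

text \<open>The extrapolations \<open>l + a t l'\<close> and \<open>x + a t x'\<close>, \<open>y + a t y'\<close> in the system make the
  primal and the dual coupling terms cancel against each other, so that the multiplier of the
  trajectory is replaced by the arbitrary \<open>q\<close>. What is left is \<open>a t\<close> times the derivative of
  the gap plus gradient terms, which convexity bounds from below by the gap itself.\<close>

lemma force_work:
  assumes t: "t \<ge> t0"
  shows "a * t * (tderiv t0 x t \<bullet> gradient f (x t) + tderiv t0 y t \<bullet> gradient g (y t)
      + (q + \<mu> *\<^sub>R residual t) \<bullet> (A (tderiv t0 x t) + B (tderiv t0 y t))) + gap q t
    \<le> force t \<bullet> (state t - (xs, ys, q) + (a * t) *\<^sub>R velocity t)"
proof -
  interpret A: bounded_linear A by (rule A)
  interpret B: bounded_linear B by (rule B)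
  define r where "r = residual t"
  define r1 where "r1 = A (tderiv t0 x t) + B (tderiv t0 y t)"
  define w where "w = l t + (a * t) *\<^sub>R tderiv t0 l t"
  define vx where "vx = x t - xs + (a * t) *\<^sub>R tderiv t0 x t"
  define vy where "vy = y t - ys + (a * t) *\<^sub>R tderiv t0 y t"
  have primal: "A vx + B vy = r + (a * t) *\<^sub>R r1"
    unfolding vx_def vy_def r_def r1_def residual_def
    by (simp add: A.add A.diff A.scaleR B.add B.diff B.scaleR feasible[symmetric] algebra_simps)
  have dual: "A (x t + (a * t) *\<^sub>R tderiv t0 x t) + B (y t + (a * t) *\<^sub>R tderiv t0 y t) - c
      = r + (a * t) *\<^sub>R r1"
    unfolding r_def r1_def residual_def
    by (simp add: A.add A.scaleR B.add B.scaleR algebra_simps)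
  have "force t \<bullet> (state t - (xs, ys, q) + (a * t) *\<^sub>R velocity t)
      = gradient f (x t) \<bullet> vx + gradient g (y t) \<bullet> vy + (w + \<mu> *\<^sub>R r) \<bullet> (A vx + B vy)
        - (r + (a * t) *\<^sub>R r1) \<bullet> (w - q)"
    unfolding force_def Let_def state_def velocity_def dual w_def[symmetric] r_def[symmetric]
    by (simp add: vx_def[symmetric] vy_def[symmetric] inner_add_left adjoint_inner[OF A]
        adjoint_inner[OF B] inner_add_right[of _ "A vx" "B vy"])
      (simp add: w_def algebra_simps)
  also have "\<dots> = gradient f (x t) \<bullet> vx + gradient g (y t) \<bullet> vy
      + (q + \<mu> *\<^sub>R r) \<bullet> (r + (a * t) *\<^sub>R r1)"
    unfolding primal by (simp add: inner_commute algebra_simps)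
  also have "\<dots> = a * t * (tderiv t0 x t \<bullet> gradient f (x t) + tderiv t0 y t \<bullet> gradient g (y t)
        + (q + \<mu> *\<^sub>R r) \<bullet> r1)
      + (gradient f (x t) \<bullet> (x t - xs) + gradient g (y t) \<bullet> (y t - ys) + q \<bullet> r + \<mu> * (norm r)\<^sup>2)"
    unfolding vx_def vy_def power2_norm_eq_inner
    by (simp add: inner_commute algebra_simps)
  finally have work: "force t \<bullet> (state t - (xs, ys, q) + (a * t) *\<^sub>R velocity t) = \<dots>" .
  have "0 \<le> \<mu> * (norm r)\<^sup>2" using pos by simp
  with convex_gradient_inequality[OF f, of "x t" xs] convex_gradient_inequality[OF g, of "y t" ys]
  have "gap q t \<le> gradient f (x t) \<bullet> (x t - xs) + gradient g (y t) \<bullet> (y t - ys) + q \<bullet> r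
      + \<mu> * (norm r)\<^sup>2"
    unfolding gap_def objective_def r_def[symmetric] by (simp add: field_simps)
  with work show ?thesis unfolding r_def r1_def by linarith
qed

lemma state_equation:
  assumes t: "t \<ge> t0"
  shows "(tderiv t0 (tderiv t0 x) t, tderiv t0 (tderiv t0 y) t, tderiv t0 (tderiv t0 l) t)
    + ((\<eta> + a) / (a * t)) *\<^sub>R velocity t + t powr (1 / a - 2) *\<^sub>R force t = 0"
  using solution t
  unfolding trials_solution_def velocity_def force_def residual_def Let_def
  by (simp add: zero_prod_def del: minus_diff_eq)

text \<open>The weight \<open>a\<^sup>2 t powr (1/a) = a\<^sup>2 t\<^sup>2 b\<close> has derivative \<open>a t b\<close>, so the gap and its
  derivative are absorbed by the work of the force, whatever the sign of the gap. This is
  why the energy decreases for every multiplier \<open>q\<close>.\<close>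

lemma energy_derivative_nonpos:
  assumes t: "t \<ge> t0"
  shows "\<exists>D\<le>0. (energy q has_real_derivative D) (at t within {t0..})"
proof -
  have tpos: "t > 0" using t pos by linarith
  define b where "b = t powr (1 / a - 2)"
  define W1 where "W1 = tderiv t0 x t \<bullet> gradient f (x t) + tderiv t0 y t \<bullet> gradient g (y t)
      + (q + \<mu> *\<^sub>R residual t) \<bullet> (A (tderiv t0 x t) + B (tderiv t0 y t))"
  define work where "work = force t \<bullet> (state t - (xs, ys, q) + (a * t) *\<^sub>R velocity t)"
  have powers: "t powr (1 / a) = t\<^sup>2 * b" "t powr (1 / a - 1) = t * b"
    using tpos by (simp_all add: b_def powr_diff power2_eq_square)
  have b: "b > 0" using tpos by (simp add: b_def)
  have weight: "((\<lambda>s. a\<^sup>2 * s powr (1 / a)) has_real_derivative a * t * b) (at t within {t0..})"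
    using DERIV_subset[OF DERIV_cmult[OF has_real_derivative_powr[OF tpos, of "1 / a"], of "a\<^sup>2"]]
      pos by (simp add: powers power2_eq_square mult.assoc)
  have "(state has_vector_derivative velocity t) (at t within {t0..})"
    "(velocity has_vector_derivative
      (tderiv t0 (tderiv t0 x) t, tderiv t0 (tderiv t0 y) t, tderiv t0 (tderiv t0 l) t))
      (at t within {t0..})"
    unfolding state_def[abs_def] velocity_def[abs_def]
    by (intro has_vector_derivative_Pair trajectory_derivatives[OF t])+
  note kinetic = anchored_energy_derivative[OF this state_equation[OF t], of "(xs, ys, q)"]
  define D where "D = a * t * b * gap q t + W1 * (a\<^sup>2 * t powr (1 / a))
      + (- (\<eta> - 1) * (a * t) * (norm (velocity t))\<^sup>2 - a * t * b * work)"
  have "(energy q has_real_derivative D) (at t within {t0..})"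
    unfolding energy_def[abs_def] D_def
    using tpos pos kinetic
    by (intro DERIV_add DERIV_mult weight gap_derivative[OF t, of q, folded W1_def])
      (auto simp: b_def work_def)
  moreover have "D = - ((\<eta> - 1) * (a * t) * (norm (velocity t))\<^sup>2)
      - a * t * b * (work - (a * t * W1 + gap q t))"
    unfolding D_def powers by (simp add: algebra_simps power2_eq_square)
  moreover have "0 \<le> (\<eta> - 1) * (a * t) * (norm (velocity t))\<^sup>2" using \<eta> pos tpos by simp
  moreover have "0 \<le> a * t * b * (work - (a * t * W1 + gap q t))"
    using force_work[OF t, of q] pos tpos b unfolding work_def W1_def by simp
  ultimately show ?thesis by (intro exI[of _ D]) linarith
qed

lemma energy_le_initial:
  assumes t: "t \<ge> t0"
  shows "energy q t \<le> energy q t0"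
proof (cases "t = t0")
  case False
  have "\<forall>s\<in>{t0..}. \<exists>D. D \<le> 0 \<and> (energy q has_real_derivative D) (at s within {t0..})"
    using energy_derivative_nonpos by auto
  from bchoice[OF this] obtain D where D: "\<And>s. s \<ge> t0 \<Longrightarrow> D s \<le> 0"
    "\<And>s. s \<ge> t0 \<Longrightarrow> (energy q has_real_derivative D s) (at s within {t0..})"
    by auto
  have "\<exists>s\<in>{t0<..<t}. energy q t - energy q t0 = D s * (t - t0)"
  proof (rule mvt_simple)
    fix s assume "t0 \<le> s" "s \<le> t"
    then show "(energy q has_derivative (*) (D s)) (at s within {t0..t})"
      using DERIV_subset[OF D(2), of s "{t0..t}"] by (simp add: has_field_derivative_def)
  qed (use t False in simp)
  then obtain s where "s \<in> {t0<..<t}" "energy q t - energy q t0 = D s * (t - t0)" by blast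
  moreover from this t D(1)[of s] have "D s * (t - t0) \<le> 0" by (simp add: mult_nonpos_nonneg)
  ultimately show ?thesis by linarith
qed simp

lemma gap_le:
  assumes t: "t \<ge> t0"
  shows "gap q t \<le> energy q t0 / a\<^sup>2 / t powr (1 / a)"
proof -
  have "a\<^sup>2 * t powr (1 / a) * gap q t \<le> energy q t"
    unfolding energy_def using \<eta> by simp
  also have "\<dots> \<le> energy q t0" by (rule energy_le_initial[OF t])
  finally show ?thesis using pos t by (simp add: field_simps)
qed

text \<open>With a nonnegative gap the initial energy bounds both squares in the energy. The velocity is
  recovered from the difference of the two vectors in them, which is \<open>a t u'\<close>.\<close>

lemma trajectory_bounds:
  assumes nonneg: "\<And>t. t \<ge> t0 \<Longrightarrow> 0 \<le> gap q t"
  obtains R where "\<And>t. t \<ge> t0 \<Longrightarrow> norm (state t) \<le> R"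
    and "\<And>t. t \<ge> t0 \<Longrightarrow> norm (velocity t) \<le> R / t"
proof -
  define p where "p = (xs, ys, q)"
  define E where "E = energy q t0"
  define P where "P = sqrt (2 * E / (\<eta> - 1))"
  define V where "V = sqrt (2 * E)"
  have bounds: "norm (state t - p) \<le> P" "norm (state t - p + (a * t) *\<^sub>R velocity t) \<le> V"
    if t: "t \<ge> t0" for t
  proof -
    have "0 \<le> a\<^sup>2 * t powr (1 / a) * gap q t" using nonneg[OF t] by simp
    moreover have "0 \<le> (\<eta> - 1) * ((norm (state t - p))\<^sup>2 / 2)" using \<eta> by simp
    moreover have "0 \<le> (norm (state t - p + (a * t) *\<^sub>R velocity t))\<^sup>2 / 2" by simp
    moreover have "energy q t \<le> E" unfolding E_def by (rule energy_le_initial[OF t])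
    ultimately have "(\<eta> - 1) * ((norm (state t - p))\<^sup>2 / 2) \<le> E"
      "(norm (state t - p + (a * t) *\<^sub>R velocity t))\<^sup>2 / 2 \<le> E"
      unfolding energy_def p_def[symmetric] by linarith+
    then have "(norm (state t - p))\<^sup>2 \<le> 2 * E / (\<eta> - 1)"
      "(norm (state t - p + (a * t) *\<^sub>R velocity t))\<^sup>2 \<le> 2 * E"
      using \<eta> by (simp_all add: field_simps)
    then show "norm (state t - p) \<le> P" "norm (state t - p + (a * t) *\<^sub>R velocity t) \<le> V"
      unfolding P_def V_def by (auto intro: real_le_rsqrt)
  qed
  have "norm (state t) \<le> max (P + norm p) ((V + P) / a)" if t: "t \<ge> t0" for t
    using bounds(1)[OF t] norm_triangle_sub[of "state t" p] by linarith
  moreover have "norm (velocity t) \<le> max (P + norm p) ((V + P) / a) / t" if t: "t \<ge> t0" for t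
  proof -
    have tpos: "t > 0" using t pos by linarith
    have "a * t * norm (velocity t) = norm ((a * t) *\<^sub>R velocity t)" using pos tpos by simp
    also have "\<dots> = norm ((state t - p + (a * t) *\<^sub>R velocity t) - (state t - p))" by simp
    also have "\<dots> \<le> V + P" 
      using norm_triangle_ineq4[of "state t - p + (a * t) *\<^sub>R velocity t" "state t - p"] bounds[OF t]
      by linarith
    finally have "norm (velocity t) \<le> (V + P) / a / t" using pos tpos by (simp add: field_simps)
    also have "\<dots> \<le> max (P + norm p) ((V + P) / a) / t"
      using tpos by (intro divide_right_mono) auto
    finally show ?thesis .
  qed
  ultimately show thesis by (rule that)
qed

end

section \<open>Saddle points and rates\<close>

lemma saddle_point_feasible:
  assumes "(xs, ys, ls) \<in> saddle_points f g A B c"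
  shows "A xs + B ys = c"
proof -
  define r where "r = A xs + B ys - c"
  have "lagrangian f g A B c xs ys (ls + r) \<le> lagrangian f g A B c xs ys ls"
    using assms unfolding saddle_points_def by blast
  then have "r \<bullet> r \<le> 0"
    unfolding lagrangian_def r_def[symmetric] by (simp add: inner_add_left)
  then have "r = 0" using inner_ge_zero[of r] by simp
  then show ?thesis by (simp add: r_def)
qed

lemma bigo_of_bound_from:
  fixes h k :: "real \<Rightarrow> real"
  assumes "\<And>t. t \<ge> t0 \<Longrightarrow> \<bar>h t\<bar> \<le> C * k t" "\<And>t. t \<ge> t0 \<Longrightarrow> 0 \<le> k t"
  shows "h \<in> O[at_top](k)"
  by (rule bigoI[of _ C], rule eventually_mono[OF eventually_ge_at_top[of t0]]) (use assms in auto)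

theorem theorem2p1:
  fixes f :: "'x::{real_inner, complete_space} \<Rightarrow> real"
    and g :: "'y::{real_inner, complete_space} \<Rightarrow> real"
    and A :: "'x \<Rightarrow> 'z::{real_inner, complete_space}"
    and B :: "'y \<Rightarrow> 'z"
    and c :: 'z
    and t0 \<mu> \<alpha>0 \<eta> :: real
    and \<alpha> \<gamma> b :: "real \<Rightarrow> real"
    and xs :: 'x and ys :: 'y and ls :: 'z
    and x :: "real \<Rightarrow> 'x" and y :: "real \<Rightarrow> 'y" and l :: "real \<Rightarrow> 'z"
  assumes "convex_on UNIV f" and "class_C1 f"
    and "convex_on UNIV g" and "class_C1 g"
    and "bounded_linear A" and "bounded_linear B"
    and "solution_set f g A B c \<noteq> {}"
    and "t0 > 0" and "\<mu> > 0" and "\<alpha>0 > 0" and "\<eta> > 1"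
    and "\<And>t. t \<ge> t0 \<Longrightarrow> \<alpha> t = \<alpha>0 * t"
    and "\<And>t. t \<ge> t0 \<Longrightarrow> \<gamma> t = (\<eta> + \<alpha>0) / (\<alpha>0 * t)"
    and "\<And>t. t \<ge> t0 \<Longrightarrow> b t = t powr (1 / \<alpha>0 - 2)"
    and "(xs, ys, ls) \<in> saddle_points f g A B c"
    and "trials_solution f g A B c \<mu> \<gamma> \<alpha> b t0 x y l"
  shows "bounded ((\<lambda>t. (x t, y t, l t)) ` {t0..}) \<and>
    (\<lambda>t. lagrangian f g A B c (x t) (y t) ls - lagrangian f g A B c xs ys ls)
      \<in> O[at_top](\<lambda>t. t powr (- 1 / \<alpha>0)) \<and>
    (\<lambda>t. (norm (A (x t) + B (y t) - c))\<^sup>2) \<in> O[at_top](\<lambda>t. t powr (- 1 / \<alpha>0)) \<and>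
    (\<lambda>t. norm (tderiv t0 x t, tderiv t0 y t, tderiv t0 l t)) \<in> O[at_top](\<lambda>t. 1 / t) \<and>
    (\<exists>C1>0. \<exists>C2>0. \<forall>t\<ge>t0.
       - C1 / t powr (1 / (2 * \<alpha>0)) \<le> objective f g (x t) (y t) - objective f g xs ys \<and>
       objective f g (x t) (y t) - objective f g xs ys \<le> C2 / t powr (1 / \<alpha>0)) \<and>
    (\<alpha>0 = 1 / 2 \<longrightarrow>
       (\<forall>t\<ge>t0. b t = 1) \<and>
       (\<lambda>t. lagrangian f g A B c (x t) (y t) ls - lagrangian f g A B c xs ys ls)
         \<in> O[at_top](\<lambda>t. 1 / t\<^sup>2) \<and>
       (\<lambda>t. (norm (A (x t) + B (y t) - c))\<^sup>2) \<in> O[at_top](\<lambda>t. 1 / t\<^sup>2) \<and>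
       (\<exists>C1>0. \<exists>C2>0. \<forall>t\<ge>t0.
          - C1 / t \<le> objective f g (x t) (y t) - objective f g xs ys \<and>
          objective f g (x t) (y t) - objective f g xs ys \<le> C2 / t\<^sup>2))"
proof -
  note hyps = assms
  have feasible: "A xs + B ys = c" using hyps(15) by (rule saddle_point_feasible)
  have "trials_solution f g A B c \<mu> (\<lambda>t. (\<eta> + \<alpha>0) / (\<alpha>0 * t)) (\<lambda>t. \<alpha>0 * t)
      (\<lambda>t. t powr (1 / \<alpha>0 - 2)) t0 x y l"
    using hyps(16) unfolding trials_solution_def by (simp add: hyps(12-14))
  then interpret trials_trajectory f g A B c t0 \<mu> \<alpha>0 \<eta> xs ys x y l
    by (rule trials_trajectory.intro[OF hyps(1-6) hyps(8-11) feasible])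
  define lgap where "lgap t = lagrangian f g A B c (x t) (y t) ls - lagrangian f g A B c xs ys ls" for t
  define fgap where "fgap t = objective f g (x t) (y t) - objective f g xs ys" for t
  define C where "C = energy ls t0 / \<alpha>0\<^sup>2"
  define K where "K = 2 * C / \<mu>"
  have tpos: "t > 0" if "t \<ge> t0" for t using that pos by linarith
  have inv_powr: "c' / t powr (1 / \<alpha>0) = c' * t powr (- 1 / \<alpha>0)" for c' t :: real
    by (simp add: powr_minus_divide)
  have lgap_fgap: "lgap t = fgap t + ls \<bullet> residual t" for t
    unfolding lgap_def fgap_def lagrangian_def residual_def by (simp add: feasible)
  have gap_lgap: "gap ls t = lgap t + \<mu> * ((norm (residual t))\<^sup>2 / 2)" for t
    unfolding lgap_fgap gap_def fgap_def by simp
  have lgap_nonneg: "0 \<le> lgap t" for t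
    using hyps(15) unfolding lgap_def saddle_points_def by auto
  have pen: "0 \<le> \<mu> * ((norm (residual t))\<^sup>2 / 2)" for t using pos by simp
  have lgap_rate: "lgap t \<le> C * t powr (- 1 / \<alpha>0)" if "t \<ge> t0" for t
    using gap_le[OF that, of ls] pen[of t] unfolding gap_lgap C_def[symmetric] inv_powr by linarith
  have residual_rate: "(norm (residual t))\<^sup>2 \<le> K * t powr (- 1 / \<alpha>0)" if "t \<ge> t0" for t
  proof -
    have "\<mu> * ((norm (residual t))\<^sup>2 / 2) \<le> C * t powr (- 1 / \<alpha>0)"
      using gap_le[OF that, of ls] lgap_nonneg[of t]
      unfolding gap_lgap C_def[symmetric] inv_powr by linarith
    then show ?thesis using pos by (simp add: K_def field_simps)
  qed
  obtain R where R: "\<And>t. t \<ge> t0 \<Longrightarrow> norm (state t) \<le> R"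
    "\<And>t. t \<ge> t0 \<Longrightarrow> norm (velocity t) \<le> R / t"
    by (rule trajectory_bounds[of ls]) (use lgap_nonneg pen in \<open>auto simp: gap_lgap\<close>)

  have bnd: "bounded ((\<lambda>t. (x t, y t, l t)) ` {t0..})"
    using R(1) unfolding bounded_iff state_def by blast
  have lag: "lgap \<in> O[at_top](\<lambda>t. t powr (- 1 / \<alpha>0))"
    by (rule bigo_of_bound_from[of t0 _ C]) (use lgap_nonneg lgap_rate in auto)
  have res: "(\<lambda>t. (norm (residual t))\<^sup>2) \<in> O[at_top](\<lambda>t. t powr (- 1 / \<alpha>0))"
    by (rule bigo_of_bound_from[of t0 _ K]) (use residual_rate in auto)
  have vel: "(\<lambda>t. norm (velocity t)) \<in> O[at_top](\<lambda>t. 1 / t)"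
    by (rule bigo_of_bound_from[of t0 _ R]) (use R(2) tpos in \<open>auto simp: less_imp_le\<close>)

  define C1 where "C1 = norm ls * sqrt K + 1"
  define C2 where "C2 = \<bar>energy 0 t0 / \<alpha>0\<^sup>2\<bar> + 1"
  have "K \<ge> 0"
    using order_trans[OF zero_le_power2 residual_rate[of t0]] tpos[of t0]
    by (simp add: zero_le_mult_iff)
  then have C12: "C1 > 0" "C2 > 0"
    unfolding C1_def C2_def by (simp_all add: add_nonneg_pos)
  have lower: "- C1 / t powr (1 / (2 * \<alpha>0)) \<le> fgap t" if t: "t \<ge> t0" for t
  proof -
    define w where "w = t powr (1 / (2 * \<alpha>0))"
    have w: "w > 0" using tpos[OF t] by (simp add: w_def)
    have "w\<^sup>2 = t powr (1 / \<alpha>0)"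
      unfolding w_def by (simp add: power2_eq_square powr_add[symmetric])
    then have "(norm (residual t))\<^sup>2 \<le> K / w\<^sup>2"
      using residual_rate[OF t] by (simp add: inv_powr)
    also have "\<dots> = (sqrt K / w)\<^sup>2" using \<open>K \<ge> 0\<close> by (simp add: power_divide)
    finally have "norm (residual t) \<le> sqrt K / w"
      by (rule power2_le_imp_le) (use w \<open>K \<ge> 0\<close> in simp)
    then have "norm ls * norm (residual t) \<le> norm ls * (sqrt K / w)"
      by (rule mult_left_mono) simp
    also have "\<dots> \<le> C1 / w"
      using w by (simp add: C1_def divide_right_mono)
    finally have "ls \<bullet> residual t \<le> C1 / w"
      using norm_cauchy_schwarz[of ls "residual t"] by linarith
    then show ?thesis using lgap_nonneg[of t] unfolding lgap_fgap w_def[symmetric] by simp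
  qed
  \<comment> \<open>The multiplier \<open>0\<close> turns the gap into the objective gap plus a nonnegative penalty.\<close>
  have upper: "fgap t \<le> C2 / t powr (1 / \<alpha>0)" if t: "t \<ge> t0" for t
  proof -
    have "fgap t \<le> gap 0 t" using pen[of t] by (simp add: gap_def fgap_def)
    also have "\<dots> \<le> energy 0 t0 / \<alpha>0\<^sup>2 / t powr (1 / \<alpha>0)" by (rule gap_le[OF t])
    also have "\<dots> \<le> C2 / t powr (1 / \<alpha>0)"
      by (rule divide_right_mono) (unfold C2_def, linarith, simp)
    finally show ?thesis .
  qed

  have two_sided: "\<exists>C1>0. \<exists>C2>0. \<forall>t\<ge>t0.
      - C1 / t powr (1 / (2 * \<alpha>0)) \<le> fgap t \<and> fgap t \<le> C2 / t powr (1 / \<alpha>0)"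
    using C12 lower upper by blast

  have special: "(\<forall>t\<ge>t0. b t = 1) \<and> lgap \<in> O[at_top](\<lambda>t. 1 / t\<^sup>2) \<and>
      (\<lambda>t. (norm (residual t))\<^sup>2) \<in> O[at_top](\<lambda>t. 1 / t\<^sup>2) \<and>
      (\<exists>C1>0. \<exists>C2>0. \<forall>t\<ge>t0. - C1 / t \<le> fgap t \<and> fgap t \<le> C2 / t\<^sup>2)" if half: "\<alpha>0 = 1 / 2"
  proof (intro conjI allI impI)
    have sq: "t powr (1 / \<alpha>0) = t\<^sup>2" "t powr (1 / (2 * \<alpha>0)) = t"
      "t powr (- 1 / \<alpha>0) = 1 / t\<^sup>2" if "t \<ge> t0" for t
      unfolding half using tpos[OF that] by (simp_all add: powr_minus_divide)
    show "lgap \<in> O[at_top](\<lambda>t. 1 / t\<^sup>2)"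
      by (rule bigo_of_bound_from[of t0 _ C])
        (use lgap_nonneg lgap_rate sq(3) in \<open>auto simp: abs_of_nonneg\<close>)
    show "(\<lambda>t. (norm (residual t))\<^sup>2) \<in> O[at_top](\<lambda>t. 1 / t\<^sup>2)"
      by (rule bigo_of_bound_from[of t0 _ K]) (use residual_rate sq(3) in auto)
    show "b t = 1" if "t0 \<le> t" for t
      using hyps(14)[OF that] half tpos[OF that] by simp
    have "- C1 / t \<le> fgap t \<and> fgap t \<le> C2 / t\<^sup>2" if t: "t \<ge> t0" for t
      using lower[OF t] upper[OF t] by (simp add: sq[OF t])
    then show "\<exists>C1>0. \<exists>C2>0. \<forall>t\<ge>t0. - C1 / t \<le> fgap t \<and> fgap t \<le> C2 / t\<^sup>2"
      using C12 by blast
  qed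

  show ?thesis
    using bnd lag res vel two_sided special
    unfolding lgap_def[abs_def] fgap_def residual_def velocity_def by (intro conjI impI) simp_all
qed

end
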